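(* For real $x>0$ let $B(x)=\frac{1}{e}\sum_{k=0}^{\infty}\frac{k^x}{k!}$. Then $\log B(x)^{1/x}$ is strictly increasing for $x\geq 1$.
   Context: Here $\log B(x)^{1/x}$ means $\log\left(B(x)^{1/x}\right)=\frac{1}{x}\log B(x)$. The $k=0$ term of $B(x)$ is $0$ for $x>0$. *)

theory Defs
  imports Complex_Main
begin

text \<open>
  Dobinski's formula extended to a real argument \<open>x > 0\<close>.  As \<open>0 powr x = 0\<close> for
  every real \<open>x\<close>, the term for \<open>k = 0\<close> vanishes.  The series converges for every real \<open>x\<close>.
\<close>

definition bell_real :: "real \<Rightarrow> real" where
  "bell_real x = 1 / exp 1 * (\<Sum>k. real k powr x / fact k)"

end

theory Submission
  imports Defs
begin

text \<open>
  Up to the factor \<open>1 / e\<close>, the series is a sum over the weights of the Poisson distribution with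
  mean \<open>1\<close>: if \<open>K\<close> has that distribution, then \<open>bell_real x\<close> is the moment \<open>E (K\<^sup>x)\<close>, and
  \<open>bell_real x powr (1 / x)\<close> is the \<open>L\<^sup>x\<close> norm of \<open>K\<close>.  On a probability space these norms increase
  with the exponent (Lyapunov), and they do so strictly unless \<open>K\<close> is almost surely constant.

  For \<open>0 < x < y\<close> put \<open>r = y / x > 1\<close> and \<open>M = E (K\<^sup>x)\<close>.  Jensen's inequality
  \<open>E ((K\<^sup>x)\<^sup>r) \<ge> M\<^sup>r\<close> comes from integrating the tangent line of \<open>t \<mapsto> t\<^sup>r\<close> at \<open>t = M\<close>, which is
  Bernoulli's inequality (\<open>Bernoulli_powr\<close>) after scaling by \<open>M\<close>.  The inequality is strict because
  the atom at \<open>K = 0\<close> lies strictly above the tangent line.  This gives \<open>bell_real_powr_less\<close>,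
  and taking logarithms gives the theorem.
\<close>

text \<open>
  For \<open>u > 0\<close> the power \<open>u powr r\<close> is \<open>exp t\<close> with \<open>t = r ln u\<close>, so the claim is \<open>r exp (t / r) \<le> exp t + (r - 1)\<close>,
  an instance of the convexity of \<open>exp\<close>.  After division by \<open>exp (t / r)\<close> it follows from the bound
  \<open>1 + z \<le> exp z\<close> at the two points \<open>z = t - t / r\<close> and \<open>z = - t / r\<close>:
  weighted by \<open>1\<close> and \<open>r - 1\<close>, the linear parts cancel.
\<close>
lemma Bernoulli_powr:
  fixes u r :: real
  assumes "0 \<le> u" "1 \<le> r"
  shows "1 + r * (u - 1) \<le> u powr r"
proof (cases "u = 0")
  case True
  then show ?thesis using assms by simp
next
  case False
  with assms have u: "u > 0" by simp
  define l where "l = ln u"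
  have u_eq: "u = exp l" and powr_eq: "u powr r = exp (r * l)"
    using u by (simp_all add: l_def powr_def)
  have "1 + (r * l - l) \<le> exp (r * l - l)"
    by (rule exp_ge_add_one_self)
  moreover have "(r - 1) * (1 + (- l)) \<le> (r - 1) * exp (- l)"
    using assms by (intro mult_left_mono exp_ge_add_one_self) auto
  ultimately have "r \<le> exp (r * l - l) + (r - 1) * exp (- l)"
    by (simp add: algebra_simps)
  then have "r * exp l \<le> (exp (r * l - l) + (r - 1) * exp (- l)) * exp l"
    by (intro mult_right_mono) auto
  also have "\<dots> = exp (r * l) + (r - 1)"
    by (simp add: distrib_right mult.assoc flip: exp_add)
  finally show ?thesis
    by (simp add: u_eq powr_eq algebra_simps flip: u_eq)
qed

text \<open>
  For \<open>n \<ge> x\<close> the term \<open>k ^ n / n!\<close> of the exponential series bounds \<open>k powr x\<close> by \<open>n! exp k\<close>,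
  which leaves the exponential series at \<open>exp 1\<close> as a majorant.
\<close>
lemma summable_powr_div_fact:
  fixes x :: real
  shows "summable (\<lambda>k. real k powr x / fact k)"
proof -
  define n where "n = nat \<lceil>x\<rceil>"
  have n: "x \<le> real n" unfolding n_def by linarith
  have bound: "real k powr x \<le> fact n * exp 1 ^ k" for k
  proof (cases "k = 0")
    case False
    have "real k powr x \<le> real k powr real n"
      using False n by (intro powr_mono) auto
    also have "\<dots> = real k ^ n"
      using False by (simp add: powr_realpow)
    also have "\<dots> \<le> fact n * exp (real k)"
    proof -
      have "(\<Sum>i\<in>{n}. inverse (fact i) * real k ^ i) \<le> (\<Sum>i. inverse (fact i) * real k ^ i)"
        by (intro sum_le_suminf summable_exp) auto
      then have "inverse (fact n) * real k ^ n \<le> exp (real k)"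
        by (simp add: exp_def scaleR_conv_of_real)
      then show ?thesis by (simp add: field_simps)
    qed
    also have "exp (real k) = exp 1 ^ k"
      by (simp flip: exp_of_nat_mult)
    finally show ?thesis .
  qed simp
  show ?thesis
  proof (rule summable_comparison_test')
    show "summable (\<lambda>k. fact n * (inverse (fact k) * (exp 1 :: real) ^ k))"
      by (intro summable_mult summable_exp)
    show "norm (real k powr x / fact k) \<le> fact n * (inverse (fact k) * exp 1 ^ k)"
      if "k \<ge> 0" for k
      using bound[of k] by (simp add: field_simps)
  qed
qed

lemma bell_real_sums:
  "(\<lambda>k. real k powr x / fact k) sums (exp 1 * bell_real x)"
  using summable_sums[OF summable_powr_div_fact, of x] by (simp add: bell_real_def)

lemma bell_real_pos: "bell_real x > 0"
proof -
  have "(\<Sum>k. real k powr x / fact k) > 0"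
    by (rule suminf_pos2[OF summable_powr_div_fact, where i = 1]) auto
  then show ?thesis by (simp add: bell_real_def)
qed

text \<open>
  Strict Jensen inequality for the Poisson weights.  The linear part of the tangent line of
  \<open>t \<mapsto> t powr (y / x)\<close> at the mean of \<open>k powr x\<close> averages out, so the tangent line contributes only
  its value at the mean, the left-hand side.
\<close>
lemma bell_real_powr_less:
  assumes "0 < x" "x < y"
  shows "bell_real x powr (y / x) < bell_real y"
proof -
  define M where "M = bell_real x"
  define r where "r = y / x"
  have M: "M > 0" by (simp add: M_def bell_real_pos)
  have r: "r > 1" using assms by (simp add: r_def)
  define tangent where "tangent k = M powr r * (1 + r * (real k powr x / M - 1))" for k
  have tangent_sums: "(\<lambda>k. tangent k / fact k) sums (exp 1 * M powr r)"
  proof -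
    have one: "(\<lambda>k. 1 / fact k) sums (exp 1 :: real)"
      using exp_converges[of "1 :: real"] by (simp add: divide_inverse)
    have "(\<lambda>k. M powr r * (1 - r) * (1 / fact k) + M powr r * r / M * (real k powr x / fact k))
          sums (M powr r * (1 - r) * exp 1 + M powr r * r / M * (exp 1 * M))"
      unfolding M_def by (intro sums_add sums_mult bell_real_sums one[unfolded M_def])
    moreover have "M powr r * (1 - r) * (1 / fact k) + M powr r * r / M * (real k powr x / fact k)
        = tangent k / fact k" for k
      by (simp add: tangent_def algebra_simps add_divide_distrib diff_divide_distrib)
    moreover have "M powr r * (1 - r) * exp 1 + M powr r * r / M * (exp 1 * M) = exp 1 * M powr r"
      using M by (simp add: algebra_simps)
    ultimately show ?thesis by simp
  qed
  have below: "tangent k \<le> real k powr y" for k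
  proof -
    have "tangent k \<le> M powr r * (real k powr x / M) powr r"
      unfolding tangent_def using M r by (intro mult_left_mono Bernoulli_powr) auto
    also have "\<dots> = real k powr y"
      using M assms by (simp add: powr_divide powr_powr r_def)
    finally show ?thesis .
  qed
  \<comment> \<open>At \<open>k = 0\<close> the tangent has the negative value \<open>(1 - r) M\<^sup>r\<close>, while the power is \<open>0\<close>.\<close>
  have strict: "tangent 0 < real 0 powr y"
    using M r by (simp add: tangent_def mult_pos_neg)
  have "0 < (\<Sum>k. real k powr y / fact k - tangent k / fact k)"
  proof (rule suminf_pos2[where i = 0])
    show "summable (\<lambda>k. real k powr y / fact k - tangent k / fact k)"
      by (intro summable_diff summable_powr_div_fact sums_summable[OF tangent_sums])
    show "0 \<le> real k powr y / fact k - tangent k / fact k" for k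
      using below[of k] by (simp add: divide_right_mono)
    show "0 < real 0 powr y / fact 0 - tangent 0 / fact 0"
      using strict by simp
  qed
  also have "\<dots> = exp 1 * bell_real y - exp 1 * M powr r"
    by (rule sums_unique[symmetric]) (intro sums_diff bell_real_sums tangent_sums)
  finally show ?thesis by (simp add: M_def r_def)
qed

theorem theorem5p2:
  "strict_mono_on {1..} (\<lambda>x::real. ln (bell_real x powr (1 / x)))"
proof (rule strict_mono_onI)
  fix x y :: real
  assume "x \<in> {1..}" "y \<in> {1..}" "x < y"
  then have xy: "0 < x" "0 < y" "x < y" by auto
  have "ln (bell_real x powr (y / x)) < ln (bell_real y)"
    using bell_real_powr_less[of x y] bell_real_pos[of x] bell_real_pos[of y] xy
    by (subst ln_less_cancel_iff) auto
  then have "y / x * ln (bell_real x) < ln (bell_real y)"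
    using bell_real_pos[of x] by (simp add: ln_powr)
  then show "ln (bell_real x powr (1 / x)) < ln (bell_real y powr (1 / y))"
    using bell_real_pos[of x] bell_real_pos[of y] xy by (simp add: ln_powr field_simps)
qed

end
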